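(* Let $m$ be a positive integer. Let $K\subset\mathbb{E}^2$ be a $2$-dimensional convex body with smooth boundary. Then $$I^m(K)=2m+1.$$
   Context: $\mathbb{E}^2$ is the Euclidean plane and $\mathbb{S}^{1}$ is its origin-centered unit circle. A $2$-dimensional convex body is a compact convex subset of $\mathbb{E}^2$ with nonempty interior; $\partial K$ and $\operatorname{int}(K)$ denote boundary and interior. The boundary of $K$ is smooth if $K$ has a unique support line at each of its boundary points. A direction $u\in\mathbb{S}^{1}$ illuminates a point $p\in\partial K$ with respect to $K$ if $p+\lambda u\in\operatorname{int}(K)$ for some $\lambda>0$. $K$ is $m$-fold illuminated by a finite multiset $U$ of directions in $\mathbb{S}^{1}$ if each point of $\partial K$ is illuminated by at least $m$ members of $U$ (counted with multiplicity) with respect to $K$. The $m$-fold illumination number $I^m(K)$ is the smallest cardinality (counted with multiplicity) of a multiset of directions that $m$-fold illuminates $K$. *)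

theory Defs
  imports "HOL-Analysis.Analysis" "HOL-Library.Multiset" "HOL-Library.Extended_Nat"
begin

definition convex_body :: "(real^2) set \<Rightarrow> bool" where
  "convex_body K \<longleftrightarrow> compact K \<and> convex K \<and> interior K \<noteq> {}"

text \<open>Support lines are point sets, not pairs of a normal vector and an offset, so that
  uniqueness below is not affected by rescaling the normal vector.\<close>

definition support_line :: "(real^2) set \<Rightarrow> (real^2) set \<Rightarrow> bool" where
  "support_line K L \<longleftrightarrow>
    (\<exists>a b. a \<noteq> 0 \<and> L = {x. a \<bullet> x = b} \<and> K \<subseteq> {x. a \<bullet> x \<le> b} \<and> K \<inter> L \<noteq> {})"

definition smooth_boundary :: "(real^2) set \<Rightarrow> bool" where
  "smooth_boundary K \<longleftrightarrow> (\<forall>p\<in>frontier K. \<exists>!L. support_line K L \<and> p \<in> L)"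

definition illuminates :: "(real^2) set \<Rightarrow> real^2 \<Rightarrow> real^2 \<Rightarrow> bool" where
  "illuminates K u p \<longleftrightarrow> (\<exists>l>0. p + l *\<^sub>R u \<in> interior K)"

definition fold_illuminated :: "nat \<Rightarrow> (real^2) set \<Rightarrow> (real^2) multiset \<Rightarrow> bool" where
  "fold_illuminated m K U \<longleftrightarrow>
    set_mset U \<subseteq> sphere 0 1 \<and>
    (\<forall>p\<in>frontier K. m \<le> size (filter_mset (\<lambda>u. illuminates K u p) U))"

text \<open>The infimum is taken in the extended naturals: a finite value is an attained minimum,
  and the value is \<open>\<infinity>\<close> exactly if no finite multiset is suitable.\<close>

definition illumination_number :: "nat \<Rightarrow> (real^2) set \<Rightarrow> enat" where
  "illumination_number m K = Inf {enat (size U) | U. fold_illuminated m K U}"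

end

theory Submission
  imports Defs
begin

text \<open>At a smooth boundary point with outer normal \<open>a\<close>, a direction \<open>u\<close> illuminates exactly
  if \<open>a \<bullet> u < 0\<close>, and every \<open>a \<noteq> 0\<close> is an outer normal somewhere. So the theorem asks for
  the least number of directions of which every open half-plane contains at least \<open>m\<close>.
  If \<open>a\<close> is orthogonal to one of the directions, the two opposite half-planes of \<open>a\<close> miss it,
  so at least \<open>2 * m + 1\<close> directions are needed. Conversely the directions of
  \<open>(-1) ^ i *\<^sub>R (1, i)\<close> for \<open>i \<le> 2 * m\<close> suffice, because \<open>a\<^sub>1 + a\<^sub>2 * i\<close> changes its sign at
  most once in \<open>i\<close>.\<close>

lemma inner_less_if_interior:
  fixes a :: "'a::real_inner"
  assumes "a \<noteq> 0" "S \<subseteq> {x. a \<bullet> x \<le> b}" "x \<in> interior S"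
  shows "a \<bullet> x < b"
proof -
  have "interior S \<subseteq> interior {x. a \<bullet> x \<le> b}"
    using assms(2) by (rule interior_mono)
  with assms(1,3) show ?thesis
    by (auto simp: interior_halfspace_le)
qed

text \<open>Shifting \<open>p\<close> by the component \<open>w\<close> of \<open>c\<close>
  orthogonal to \<open>a\<close> stays in the common hyperplane, so \<open>w\<close> is orthogonal
  to \<open>c\<close> as well and hence to itself.\<close>

lemma hyperplane_eq_imp_parallel:
  fixes a c p :: "'a::real_inner"
  assumes "a \<noteq> 0" and eq: "{x. a \<bullet> x = a \<bullet> p} = {x. c \<bullet> x = c \<bullet> p}"
  obtains t where "c = t *\<^sub>R a"
proof -
  define t where "t = (a \<bullet> c) / (a \<bullet> a)"
  define w where "w = c - t *\<^sub>R a"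
  have aw: "a \<bullet> w = 0"
    using assms(1) by (simp add: w_def t_def inner_diff_right)
  then have "p + w \<in> {x. a \<bullet> x = a \<bullet> p}"
    by (simp add: inner_add_right)
  then have "c \<bullet> w = 0"
    unfolding eq by (simp add: inner_add_right)
  then have "w \<bullet> w = 0"
    using aw by (simp add: w_def inner_diff_left)
  then have "c = t *\<^sub>R a"
    by (simp add: w_def)
  then show thesis ..
qed

lemma illuminates_imp_inner_neg:
  assumes "a \<noteq> 0" "K \<subseteq> {x. a \<bullet> x \<le> a \<bullet> p}" "illuminates K u p"
  shows "a \<bullet> u < 0"
proof -
  obtain l where "l > 0" "p + l *\<^sub>R u \<in> interior K"
    using assms(3) by (auto simp: illuminates_def)
  then have "a \<bullet> (p + l *\<^sub>R u) < a \<bullet> p"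
    using inner_less_if_interior assms(1,2) by blast
  then show ?thesis
    using \<open>l > 0\<close> by (simp add: inner_add_right mult_less_0_iff)
qed

text \<open>If the open ray from \<open>p\<close> along \<open>u\<close> missed the interior, a line
  would separate the two. That line supports \<open>K\<close> at \<open>p\<close>, so smoothness
  identifies it with the support line of normal \<open>a\<close>, yet \<open>u\<close> does not
  point to the inner side of it.\<close>

lemma inner_neg_imp_illuminates:
  assumes "convex K" "interior K \<noteq> {}" "closed K"
    and "smooth_boundary K" "p \<in> frontier K"
    and "a \<noteq> 0" "K \<subseteq> {x. a \<bullet> x \<le> a \<bullet> p}" "a \<bullet> u < 0"
  shows "illuminates K u p"
proof (rule ccontr)
  assume not_ill: "\<not> illuminates K u p"
  have pK: "p \<in> K"
    using assms(3,5) frontier_subset_closed by blast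
  have support: "support_line K {x. d \<bullet> x = d \<bullet> p}"
    if "d \<noteq> 0" "K \<subseteq> {x. d \<bullet> x \<le> d \<bullet> p}" for d
    using that pK unfolding support_line_def by blast
  define R where "R = (\<lambda>l. p + l *\<^sub>R u) ` {0<..}"
  have "convex R"
  proof -
    have "R = (+) p ` (\<lambda>l. l *\<^sub>R u) ` {0<..}"
      by (auto simp: R_def image_image)
    moreover have "convex ((\<lambda>l. l *\<^sub>R u) ` {0<..})"
      by (intro convex_linear_image linearI)
        (auto simp: scaleR_add_left convex_real_interval)
    ultimately show ?thesis
      by (simp only: convex_translation)
  qed
  moreover have "R \<noteq> {}"
    by (auto simp: R_def)
  moreover have "interior K \<inter> R = {}"
    using not_ill by (auto simp: R_def illuminates_def)
  ultimately obtain c b where "c \<noteq> 0"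
    and int_le: "\<forall>x\<in>interior K. c \<bullet> x \<le> b" and R_ge: "\<forall>x\<in>R. b \<le> c \<bullet> x"
    using separating_hyperplane_sets[of "interior K" R] assms(1,2) convex_interior by blast
  have "closure (interior K) \<subseteq> {x. c \<bullet> x \<le> b}"
    using int_le by (intro closure_minimal closed_halfspace_le) auto
  then have K_le: "K \<subseteq> {x. c \<bullet> x \<le> b}"
    using assms(1-3) by (simp add: convex_closure_interior)
  have ray: "b \<le> c \<bullet> p + l * (c \<bullet> u)" if "l > 0" for l
    using R_ge that by (auto simp: R_def inner_add_right)
  \<comment> \<open>The ray omits its endpoint \<open>p\<close>, so the bound at \<open>p\<close>
    comes from letting \<open>l\<close> tend to 0.\<close>
  have "((\<lambda>l. c \<bullet> p + l * (c \<bullet> u)) \<longlongrightarrow> c \<bullet> p + 0 * (c \<bullet> u)) (at_right 0)"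
    by (intro tendsto_intros)
  then have "b \<le> c \<bullet> p + 0 * (c \<bullet> u)"
    by (rule tendsto_lowerbound)
      (auto intro!: eventually_at_right_less[THEN eventually_mono] ray)
  then have b: "b = c \<bullet> p"
    using K_le pK by auto
  have cu: "c \<bullet> u \<ge> 0"
    using ray[of 1] b by simp
  have "{x. a \<bullet> x = a \<bullet> p} = {x. c \<bullet> x = c \<bullet> p}"
    using support[of a] support[of c] assms(4-7) K_le b \<open>c \<noteq> 0\<close>
    unfolding smooth_boundary_def by auto
  then obtain t where t: "c = t *\<^sub>R a"
    using hyperplane_eq_imp_parallel assms(6) by blast
  \<comment> \<open>Equal lines only make the normals parallel; an interior point, strictly below
    both bounds, fixes the sign of \<open>t\<close>.\<close>
  obtain q where q: "q \<in> interior K"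
    using assms(2) by blast
  have "a \<bullet> q < a \<bullet> p" "c \<bullet> q < c \<bullet> p"
    using inner_less_if_interior q assms(6,7) K_le b \<open>c \<noteq> 0\<close> by blast+
  then have "t > 0"
    by (cases t "0 :: real" rule: linorder_cases) (auto simp: t)
  then have "c \<bullet> u < 0"
    using assms(8) by (simp add: t mult_less_0_iff)
  with cu show False
    by simp
qed

text \<open>The linear functional of \<open>a\<close> attains its maximum on \<open>K\<close>, and
  never at an interior point.\<close>

lemma obtain_frontier_point_with_normal:
  fixes K :: "'a::euclidean_space set"
  assumes "compact K" "K \<noteq> {}" "a \<noteq> 0"
  obtains p where "p \<in> frontier K" "K \<subseteq> {x. a \<bullet> x \<le> a \<bullet> p}"
proof -
  obtain p where p: "p \<in> K" "K \<subseteq> {x. a \<bullet> x \<le> a \<bullet> p}"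
    using continuous_attains_sup[OF assms(1,2)
        continuous_on_inner[OF continuous_on_const continuous_on_id], of a]
    by auto
  then have "p \<notin> interior K"
    using inner_less_if_interior[OF assms(3) p(2)] by blast
  then have "p \<in> frontier K"
    using p(1) closure_subset[of K] by (auto simp: frontier_def)
  then show thesis
    using p(2) that by blast
qed

lemma fold_illuminated_imp_size_ge:
  assumes "m > 0" "compact K" "K \<noteq> {}" "fold_illuminated m K U"
  shows "2 * m + 1 \<le> size U"
proof -
  have half: "m \<le> size {#u \<in># U. a \<bullet> u < 0#}" if nz: "a \<noteq> 0" for a
  proof -
    obtain p where p: "p \<in> frontier K" "K \<subseteq> {x. a \<bullet> x \<le> a \<bullet> p}"
      by (rule obtain_frontier_point_with_normal[OF assms(2,3) nz])
    have "m \<le> size {#u \<in># U. illuminates K u p#}"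
      using assms(4) p(1) by (simp add: fold_illuminated_def)
    also have "\<dots> \<le> size {#u \<in># U. a \<bullet> u < 0#}"
      using illuminates_imp_inner_neg[OF nz p(2)]
      by (intro size_mset_mono filter_mset_mono_strong) auto
    finally show ?thesis .
  qed
  \<comment> \<open>Any nonzero vector would do: \<open>e\<close> only serves to extract a nonzero
    member \<open>v\<close> of \<open>U\<close>.\<close>
  define e :: "real^2" where "e = axis 1 1"
  have "e \<noteq> 0"
    by (simp add: e_def axis_eq_0_iff)
  then have "{#u \<in># U. e \<bullet> u < 0#} \<noteq> {#}"
    using half[of e] assms(1) by force
  then obtain v where "v \<in># {#u \<in># U. e \<bullet> u < 0#}"
    by (rule multiset_nonemptyE)
  then have v: "v \<in># U" "e \<bullet> v < 0"
    by simp_all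
  \<comment> \<open>This is \<open>v\<close> turned by a right angle, so that \<open>v\<close> lies
    on the line between the half-planes of \<open>a\<close> and \<open>- a\<close>.\<close>
  define a :: "real^2" where "a = vector [- v $ 2, v $ 1]"
  have av: "a \<bullet> v = 0"
    by (simp add: a_def inner_vec_def sum_2)
  have "v \<noteq> 0"
    using v(2) by auto
  then have "a \<noteq> 0"
    by (auto simp: a_def vec_eq_iff forall_2)
  have "size {#u \<in># U. a \<bullet> u < 0#} + size {#u \<in># U. - a \<bullet> u < 0#}
      + size {#u \<in># U. a \<bullet> u = 0#} = size U"
    by (induction U) (auto split: if_splits)
  moreover have "v \<in># {#u \<in># U. a \<bullet> u = 0#}"
    using v(1) av by simp
  then have "size {#u \<in># U. a \<bullet> u = 0#} > 0"
    by (metis empty_iff nonempty_has_size set_mset_empty)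
  ultimately show ?thesis
    using half[of a] half[of "- a"] \<open>a \<noteq> 0\<close> by simp
qed

text \<open>Here \<open>sgn\<close> normalises to unit length; the positive factor does not change
  the sign of inner products.\<close>

definition alternating_direction :: "nat \<Rightarrow> real^2" where
  "alternating_direction i = (-1) ^ i *\<^sub>R sgn (vector [1, real i])"

lemma inner_alternating_direction_neg_iff:
  "a \<bullet> alternating_direction i < 0 \<longleftrightarrow> (-1) ^ i * (a $ 1 + a $ 2 * real i) < 0"
proof -
  have "vector [1, real i] \<noteq> (0 :: real^2)"
    by (auto simp: vec_eq_iff forall_2)
  then have "inverse (norm (vector [1, real i] :: real^2)) > 0"
    by simp
  moreover have "a \<bullet> alternating_direction i = inverse (norm (vector [1, real i] :: real^2))
      * ((-1) ^ i * (a $ 1 + a $ 2 * real i))"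
    by (simp add: alternating_direction_def sgn_div_norm inner_vec_def sum_2 algebra_simps)
  ultimately show ?thesis
    by (simp only: mult_less_0_iff) auto
qed

lemma norm_alternating_direction: "norm (alternating_direction i) = 1"
proof -
  have "vector [1, real i] \<noteq> (0 :: real^2)"
    by (auto simp: vec_eq_iff forall_2)
  then show ?thesis
    by (simp add: alternating_direction_def norm_sgn)
qed

text \<open>If \<open>a\<^sub>2 \<ge> 0\<close>, each of the pairs \<open>{2r, 2r + 1}\<close> contributes an index; otherwise each of
  the pairs \<open>{2r + 1, 2r + 2}\<close> does.\<close>

lemma card_alternating_direction_ge:
  assumes "a \<noteq> 0"
  shows "m \<le> card {i \<in> {..2 * m}. a \<bullet> alternating_direction i < 0}"
proof -
  define f where "f i = a $ 1 + a $ 2 * real i" for i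
  define N where "N = {i \<in> {..2 * m}. a \<bullet> alternating_direction i < 0}"
  have N: "i \<in> N \<longleftrightarrow> i \<le> 2 * m \<and> (if even i then f i < 0 else f i > 0)" for i
    by (auto simp: N_def f_def inner_alternating_direction_neg_iff)
  have nz: "a $ 1 \<noteq> 0 \<or> a $ 2 \<noteq> 0"
    using assms by (auto simp: vec_eq_iff forall_2)
  have "\<exists>g. inj g \<and> g ` {..<m} \<subseteq> N"
  proof (cases "a $ 2 \<ge> 0")
    case True
    \<comment> \<open>For \<open>a $ 2 = 0\<close> the function \<open>f\<close> is a nonzero
      constant, which gives the strict inequality.\<close>
    have pos: "f (2 * r + 1) > 0" if "\<not> f (2 * r) < 0" for r
      using True that nz by (cases "a $ 2 = 0") (auto simp: f_def algebra_simps)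
    define g where "g r = (if f (2 * r) < 0 then 2 * r else 2 * r + 1)" for r
    have "g r div 2 = r" for r
      by (simp add: g_def)
    then have "inj g"
      by (rule inj_on_inverseI)
    moreover have "g ` {..<m} \<subseteq> N"
      using pos by (auto simp: g_def N)
    ultimately show ?thesis
      by blast
  next
    case False
    have neg: "f (2 * r + 2) < 0" if "\<not> f (2 * r + 1) > 0" for r
      using False that by (auto simp: f_def algebra_simps)
    \<comment> \<open>For \<open>r = m - 1\<close> the pair reaches \<open>2 * m\<close>, the last
      of the \<open>2 * m + 1\<close> indices.\<close>
    define g where "g r = (if f (2 * r + 1) > 0 then 2 * r + 1 else 2 * r + 2)" for r
    have "(g r - 1) div 2 = r" for r
      by (simp add: g_def)
    then have "inj g"
      by (rule inj_on_inverseI)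
    moreover have "g ` {..<m} \<subseteq> N"
      using neg by (auto simp: g_def N)
    ultimately show ?thesis
      by blast
  qed
  then obtain g where "inj g" "g ` {..<m} \<subseteq> N"
    by blast
  moreover have "finite N"
    by (simp add: N_def)
  ultimately have "card {..<m} \<le> card N"
    by (meson card_inj_on_le inj_on_subset subset_UNIV)
  then show ?thesis
    by (simp add: N_def)
qed

lemma fold_illuminated_alternating_direction:
  assumes "convex_body K" "smooth_boundary K"
  shows "fold_illuminated m K (image_mset alternating_direction (mset_set {..2 * m}))"
  unfolding fold_illuminated_def
proof (intro conjI ballI)
  show "set_mset (image_mset alternating_direction (mset_set {..2 * m})) \<subseteq> sphere 0 1"
    by (auto simp: norm_alternating_direction)
next
  fix p assume p: "p \<in> frontier K"
  have body: "convex K" "interior K \<noteq> {}" "closed K"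
    using assms(1) by (auto simp: convex_body_def compact_imp_closed)
  obtain a where a: "a \<noteq> 0" "K \<subseteq> {x. a \<bullet> x \<le> a \<bullet> p}"
    using assms(2) p unfolding smooth_boundary_def support_line_def by fast
  have "m \<le> card {i \<in> {..2 * m}. a \<bullet> alternating_direction i < 0}"
    by (rule card_alternating_direction_ge) fact
  also have "\<dots> \<le> card {i \<in> {..2 * m}. illuminates K (alternating_direction i) p}"
    using inner_neg_imp_illuminates[OF body assms(2) p a]
    by (intro card_mono) auto
  finally show "m \<le> size {#u \<in># image_mset alternating_direction (mset_set {..2 * m}).
      illuminates K u p#}"
    by (simp add: filter_mset_image_mset filter_mset_mset_set)
qed

theorem theorem1p6:
  fixes m :: nat and K :: "(real^2) set"
  assumes "m > 0" and "convex_body K" and "smooth_boundary K"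
  shows "illumination_number m K = enat (2 * m + 1)"
  unfolding illumination_number_def
proof (rule antisym)
  let ?U = "image_mset alternating_direction (mset_set {..2 * m})"
  have "enat (size ?U) \<in> {enat (size U) | U. fold_illuminated m K U}"
    using fold_illuminated_alternating_direction assms(2,3) by blast
  then have "Inf {enat (size U) | U. fold_illuminated m K U} \<le> enat (size ?U)"
    by (rule Inf_lower)
  then show "Inf {enat (size U) | U. fold_illuminated m K U} \<le> enat (2 * m + 1)"
    by simp
next
  have "compact K" "K \<noteq> {}"
    using assms(2) interior_subset by (auto simp: convex_body_def)
  then show "enat (2 * m + 1) \<le> Inf {enat (size U) | U. fold_illuminated m K U}"
    using fold_illuminated_imp_size_ge[OF assms(1)] by (intro Inf_greatest) fastforce
qed

end
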